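(* Let $\mathcal{X}$ be a finite set with $M=|\mathcal{X}|$ and $G$ a finite commutative group with $N=|G|$, and let $q<k$ be nonnegative integers. Consider the Oracle Interrogation problem: given $q$ quantum queries to a function $A:\mathcal{X}\to G$ drawn uniformly at random among all such functions, output $k$ distinct inputs $y_1,\dots,y_k\in\mathcal{X}$ (which may be chosen after the queries) together with the values $A(y_1),\dots,A(y_k)$. The maximum success probability of any $q$-query quantum algorithm for this problem is \[\frac{1}{N^k}\sum_{i=0}^q\binom{k}{i}(N-1)^i.\]
   Context: A quantum query to $A$ is the unitary $|x,g,z\rangle\mapsto|x,g+A(x),z\rangle$; queries may be adaptive. Success means all $k$ output pairs are correct and the inputs are distinct. Success probability is averaged over uniform $A$.
   Formalization: The formal theorem additionally assumes k ≤ M; for k > M no k distinct inputs exist, so the success probability is 0 while the stated formula is positive, and the claim fails there. *)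

theory Defs
  imports Complex_Main "HOL-Library.Cardinality" "HOL-Library.Nonpos_Ints"
begin

text \<open>
  The Hilbert space with finite orthonormal basis \<open>B\<close> is represented by functions on \<open>B\<close>,
  and an operator by its matrix of entries \<open>U i j\<close> (row \<open>i\<close>, column \<open>j\<close>).
  Every sum ranges over \<open>B\<close>, so values outside \<open>B\<close> are irrelevant.
\<close>

type_synonym 'b state = "'b \<Rightarrow> complex"
type_synonym 'b operator = "'b \<Rightarrow> 'b \<Rightarrow> complex"

definition apply_op :: "'b set \<Rightarrow> 'b operator \<Rightarrow> 'b state \<Rightarrow> 'b state" where
  "apply_op B U \<psi> = (\<lambda>i. \<Sum>j\<in>B. U i j * \<psi> j)"

definition unit_state_on :: "'b set \<Rightarrow> 'b state \<Rightarrow> bool" where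
  "unit_state_on B \<psi> \<longleftrightarrow> (\<Sum>i\<in>B. (cmod (\<psi> i))\<^sup>2) = 1"

definition unitary_on :: "'b set \<Rightarrow> 'b operator \<Rightarrow> bool" where
  "unitary_on B U \<longleftrightarrow>
     (\<forall>i\<in>B. \<forall>j\<in>B. (\<Sum>l\<in>B. cnj (U l i) * U l j) = of_bool (i = j)) \<and>
     (\<forall>i\<in>B. \<forall>j\<in>B. (\<Sum>l\<in>B. U i l * cnj (U j l)) = of_bool (i = j))"

definition quad_form :: "'b set \<Rightarrow> 'b operator \<Rightarrow> 'b state \<Rightarrow> complex" where
  "quad_form B P \<psi> = (\<Sum>i\<in>B. \<Sum>j\<in>B. cnj (\<psi> i) * P i j * \<psi> j)"

text \<open>Over the complex numbers, a real-valued quadratic form already makes \<open>P\<close> self-adjoint.\<close>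

definition psd_on :: "'b set \<Rightarrow> 'b operator \<Rightarrow> bool" where
  "psd_on B P \<longleftrightarrow> (\<forall>\<psi>. quad_form B P \<psi> \<in> \<real>\<^sub>\<ge>\<^sub>0)"

text \<open>Positive operator-valued measure with finite outcome set \<open>R\<close>.\<close>

definition povm_on :: "'b set \<Rightarrow> 'r set \<Rightarrow> ('r \<Rightarrow> 'b operator) \<Rightarrow> bool" where
  "povm_on B R E \<longleftrightarrow>
     (\<forall>r\<in>R. psd_on B (E r)) \<and>
     (\<forall>i\<in>B. \<forall>j\<in>B. (\<Sum>r\<in>R. E r i j) = of_bool (i = j))"

text \<open>
  Computational basis \<open>|x,g,z\<rangle>\<close>: the query registers range over the finite type \<open>'x\<close> and the
  finite commutative group \<open>'g\<close>, and the workspace register \<open>z\<close> has arbitrary finite dimension \<open>d\<close>.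
\<close>

definition qbasis :: "nat \<Rightarrow> ('x \<times> 'g \<times> nat) set" where
  "qbasis d = UNIV \<times> UNIV \<times> {..<d}"

text \<open>Matrix of the map \<open>|x,g,z\<rangle> \<mapsto> |x,g + A x,z\<rangle>\<close>.\<close>

definition query_op :: "('x \<Rightarrow> 'g::ab_group_add) \<Rightarrow> ('x \<times> 'g \<times> nat) operator" where
  "query_op A = (\<lambda>i (x, g, z). of_bool (i = (x, g + A x, z)))"

text \<open>
  An algorithm prepares \<open>init\<close>, applies \<open>gate n\<close> after the query number \<open>n\<close> (counted from 0), and
  finally performs the measurement \<open>meas\<close>. Only the queries depend on the oracle. A unitary
  preceding the first query is absorbed in \<open>init\<close>, which is an arbitrary unit vector.
  An outcome is a list of input-value pairs.
\<close>

record ('x, 'g) qalg =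
  wdim :: nat
  init :: "('x \<times> 'g \<times> nat) state"
  gate :: "nat \<Rightarrow> ('x \<times> 'g \<times> nat) operator"
  meas :: "('x \<times> 'g) list \<Rightarrow> ('x \<times> 'g \<times> nat) operator"

definition outcomes :: "nat \<Rightarrow> ('x \<times> 'g) list set" where
  "outcomes k = {r. length r = k}"

definition query_algorithm ::
    "nat \<Rightarrow> nat \<Rightarrow> ('x::finite, 'g::{finite, ab_group_add}) qalg \<Rightarrow> bool" where
  "query_algorithm q k a \<longleftrightarrow>
     unit_state_on (qbasis (wdim a)) (init a) \<and>
     (\<forall>n<q. unitary_on (qbasis (wdim a)) (gate a n)) \<and>
     povm_on (qbasis (wdim a)) (outcomes k) (meas a)"

primrec state_after ::
    "('x::finite, 'g::{finite, ab_group_add}) qalg \<Rightarrow> ('x \<Rightarrow> 'g) \<Rightarrow> nat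
      \<Rightarrow> ('x \<times> 'g \<times> nat) state" where
  "state_after a A 0 = init a"
| "state_after a A (Suc n) =
     apply_op (qbasis (wdim a)) (gate a n)
       (apply_op (qbasis (wdim a)) (query_op A) (state_after a A n))"

definition correct_output :: "('x \<Rightarrow> 'g) \<Rightarrow> ('x \<times> 'g) list \<Rightarrow> bool" where
  "correct_output A r \<longleftrightarrow> distinct (map fst r) \<and> (\<forall>(y, v)\<in>set r. A y = v)"

definition outcome_prob ::
    "nat \<Rightarrow> ('x::finite, 'g::{finite, ab_group_add}) qalg \<Rightarrow> ('x \<Rightarrow> 'g)
      \<Rightarrow> ('x \<times> 'g) list \<Rightarrow> real" where
  "outcome_prob q a A r = Re (quad_form (qbasis (wdim a)) (meas a r) (state_after a A q))"

definition success_prob ::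
    "nat \<Rightarrow> nat \<Rightarrow> ('x::finite, 'g::{finite, ab_group_add}) qalg \<Rightarrow> real" where
  "success_prob q k a =
     (\<Sum>A\<in>(UNIV :: ('x \<Rightarrow> 'g) set). \<Sum>r | r \<in> outcomes k \<and> correct_output A r.
        outcome_prob q a A r) / real CARD('x \<Rightarrow> 'g)"

definition is_maximum :: "real \<Rightarrow> real set \<Rightarrow> bool" where
  "is_maximum m S \<longleftrightarrow> m \<in> S \<and> (\<forall>s\<in>S. s \<le> m)"

end

theory Submission
  imports Defs "HOL-Library.FuncSet"
begin

text \<open>
  After \<open>q\<close> queries every amplitude is, as a function of the oracle \<open>A\<close>, a combination of functions
  that depend on at most \<open>q\<close> values of \<open>A\<close>. Let \<open>Y\<close> be the \<open>k\<close> inputs of an outcome, and fix \<open>A\<close> off \<open>Y\<close>.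
  The space of such functions of \<open>A\<close> on \<open>Y\<close> has a reproducing kernel \<open>K\<close>, obtained by splitting the
  functions of each coordinate into constants and functions of mean zero and keeping the products with at
  most \<open>q\<close> factors of the second kind. By the Cauchy-Schwarz inequality for the positive form of the
  outcome, the probability of the outcome at \<open>A\<close> is at most \<open>K A A\<close> times the sum of its probabilities
  over all oracles that agree with \<open>A\<close> off \<open>Y\<close>. Since \<open>K A A\<close> is the claimed value and the
  probabilities of all outcomes sum to one, the upper bound follows.

  The bound is attained by preparing a normalised multiple of \<open>K A\<close> on a table of registers. No characters
  are needed: the component of \<open>K A\<close> with mean-zero factors on \<open>S\<close> is the translate by \<open>A\<close> of the same
  component of \<open>K 0\<close>, and it takes \<open>card S\<close> queries to perform this translation.
\<close>


section \<open>Sums of products over function spaces\<close>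

text \<open>The oracles agreeing with \<open>A\<close> off \<open>Y\<close> form a product set, with
  all of the group on \<open>Y\<close> and a singleton elsewhere, so the sum of products
  factorises.\<close>

lemma sum_prod_agree_off:
  fixes F :: "'x::finite \<Rightarrow> 'g::finite \<Rightarrow> 'c::comm_semiring_1"
  shows "(\<Sum>B | \<forall>x. x \<notin> Y \<longrightarrow> B x = A x. \<Prod>x\<in>UNIV. F x (B x)) =
    (\<Prod>x\<in>UNIV. if x \<in> Y then \<Sum>b\<in>UNIV. F x b else F x (A x))"
proof -
  have "{B. \<forall>x. x \<notin> Y \<longrightarrow> B x = A x} = PiE UNIV (\<lambda>x. if x \<in> Y then UNIV else {A x})"
    by (auto simp: PiE_def Pi_def)
  then have "(\<Sum>B | \<forall>x. x \<notin> Y \<longrightarrow> B x = A x. \<Prod>x\<in>UNIV. F x (B x)) =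
      (\<Prod>x\<in>UNIV. \<Sum>b\<in>(if x \<in> Y then UNIV else {A x}). F x b)"
    by (simp add: prod_sum_PiE)
  also have "\<dots> = (\<Prod>x\<in>UNIV. if x \<in> Y then \<Sum>b\<in>UNIV. F x b else F x (A x))"
    by (intro prod.cong) auto
  finally show ?thesis .
qed

lemma sum_prod_UNIV:
  fixes F :: "'x::finite \<Rightarrow> 'g::finite \<Rightarrow> 'c::comm_semiring_1"
  shows "(\<Sum>B\<in>UNIV. \<Prod>x\<in>UNIV. F x (B x)) = (\<Prod>x\<in>UNIV. \<Sum>b\<in>UNIV. F x b)"
  using sum_prod_agree_off[of F UNIV] by simp

section \<open>The projection onto functions of low degree\<close>

text \<open>On functions of one coordinate, \<open>coord_kernel True\<close> is the kernel of the projection onto the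
  functions of mean zero and \<open>coord_kernel False\<close> that of the projection onto the constants.\<close>

definition coord_kernel :: "bool \<Rightarrow> 'g::finite \<Rightarrow> 'g \<Rightarrow> real" where
  "coord_kernel s a b = (if s then of_bool (a = b) - 1 / real CARD('g) else 1 / real CARD('g))"

text \<open>Tensor product of the one-coordinate projections: onto mean zero on \<open>S\<close>,
  onto constants on \<open>Y - S\<close>. Coordinates outside \<open>Y\<close> are ignored, because
  they are held fixed or \<open>Y\<close> is everything.\<close>

definition proj_kernel :: "'x set \<Rightarrow> 'x set \<Rightarrow> ('x \<Rightarrow> 'g::finite) \<Rightarrow> ('x \<Rightarrow> 'g) \<Rightarrow> real" where
  "proj_kernel Y S A B = (\<Prod>x\<in>Y. coord_kernel (x \<in> S) (A x) (B x))"

definition low_kernel ::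
    "nat \<Rightarrow> 'x::finite set \<Rightarrow> ('x \<Rightarrow> 'g::finite) \<Rightarrow> ('x \<Rightarrow> 'g) \<Rightarrow> real" where
  "low_kernel n Y A B = (\<Sum>S | S \<subseteq> Y \<and> card S \<le> n. proj_kernel Y S A B)"

lemma sum_coord_kernel:
  fixes \<phi> :: "'g::finite \<Rightarrow> complex"
  shows "(\<Sum>b\<in>UNIV. of_real (coord_kernel s a b) * \<phi> b) =
    (if s then \<phi> a - (\<Sum>b\<in>UNIV. \<phi> b) / of_nat CARD('g) else (\<Sum>b\<in>UNIV. \<phi> b) / of_nat CARD('g))"
proof -
  have "(\<Sum>b\<in>UNIV. of_real (of_bool (a = b)) * \<phi> b) = (\<Sum>b\<in>UNIV. if a = b then \<phi> b else 0)"
    by (intro sum.cong) auto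
  then have "(\<Sum>b\<in>UNIV. of_real (of_bool (a = b)) * \<phi> b) = \<phi> a"
    by simp
  then show ?thesis
    by (simp add: coord_kernel_def left_diff_distrib sum_subtractf sum_divide_distrib)
qed

lemma coord_kernel_sym: "coord_kernel s a b = coord_kernel s b a"
  by (simp add: coord_kernel_def eq_commute)

lemma sum_coord_kernel_mult:
  fixes a c :: "'g::finite"
  shows "(\<Sum>b\<in>UNIV. coord_kernel s a b * coord_kernel s c b) = coord_kernel s a c"
proof -
  have mean: "(\<Sum>b\<in>UNIV. coord_kernel s c b) = of_bool (\<not> s)"
    by (simp add: coord_kernel_def sum_subtractf)
  \<comment> \<open>Over the complex numbers \<open>sum_coord_kernel\<close> applies with a row of
    the kernel as \<phi>; \<open>mean\<close> supplies the average.\<close>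
  have "complex_of_real (\<Sum>b\<in>UNIV. coord_kernel s a b * coord_kernel s c b) =
      (\<Sum>b\<in>UNIV. of_real (coord_kernel s a b) * of_real (coord_kernel s c b))"
    by simp
  also have "\<dots> = of_real (coord_kernel s c a)"
    unfolding sum_coord_kernel of_real_sum[symmetric] mean by (simp add: coord_kernel_def)
  also have "\<dots> = of_real (coord_kernel s a c)"
    by (simp only: coord_kernel_sym)
  finally show ?thesis
    using of_real_eq_iff by blast
qed

lemma coord_kernel_add: "coord_kernel True a b + coord_kernel False a b = of_bool (a = b)"
  by (simp add: coord_kernel_def)

text \<open>The kernel depends only on whether its arguments are equal, so shifting a register
  recentres the kernel. This takes the place of a Fourier transform.\<close>

lemma coord_kernel_translate:
  "coord_kernel s a (b - c) = coord_kernel s (a + c) (b :: 'g::{finite, ab_group_add})"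
  by (auto simp: coord_kernel_def algebra_simps)

text \<open>The functions of a table \<open>A\<close> spanned by the products of one-coordinate functions of which at
  most \<open>n\<close> are not constant; these are the polynomials of degree at most \<open>n\<close> in the indicators
  of \<open>A x = u\<close>.\<close>

inductive low_degree :: "nat \<Rightarrow> (('x::finite \<Rightarrow> 'g::finite) \<Rightarrow> complex) \<Rightarrow> bool" for n where
  product: "card {x. \<exists>a b. \<phi> x a \<noteq> \<phi> x b} \<le> n \<Longrightarrow> low_degree n (\<lambda>A. \<Prod>x\<in>UNIV. \<phi> x (A x))"
| add: "low_degree n f \<Longrightarrow> low_degree n g \<Longrightarrow> low_degree n (\<lambda>A. f A + g A)"

text \<open>A factor depending on one coordinate is absorbed there, so the result is again a product
  of one-coordinate functions.\<close>

lemma prod_fun_upd_mult: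
  fixes \<phi> :: "'x::finite \<Rightarrow> 'g \<Rightarrow> complex"
  shows "(\<Prod>x\<in>UNIV. (\<phi>(y := \<lambda>b. c b * \<phi> y b)) x (A x)) = c (A y) * (\<Prod>x\<in>UNIV. \<phi> x (A x))"
proof -
  have "(\<Prod>x\<in>UNIV. (\<phi>(y := \<lambda>b. c b * \<phi> y b)) x (A x)) =
      (\<Prod>x\<in>UNIV. (if x = y then c (A y) else 1) * \<phi> x (A x))"
    by (intro prod.cong) auto
  then show ?thesis
    by (simp add: prod.distrib)
qed

lemma low_degree_scale:
  assumes "low_degree n f"
  shows "low_degree n (\<lambda>A. c * f A)"
  using assms
proof induction
  case (product \<phi>)
  \<comment> \<open>The scalar is absorbed at an arbitrary coordinate; a constant factor stays
    constant there.\<close>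
  let ?\<phi> = "\<phi>(undefined := \<lambda>b. c * \<phi> undefined b)"
  have "card {x. \<exists>a b. ?\<phi> x a \<noteq> ?\<phi> x b} \<le> card {x. \<exists>a b. \<phi> x a \<noteq> \<phi> x b}"
    by (intro card_mono) auto
  then have "low_degree n (\<lambda>A. \<Prod>x\<in>UNIV. ?\<phi> x (A x))"
    using product by (intro low_degree.product) linarith
  then show ?case
    by (simp only: prod_fun_upd_mult[of \<phi> undefined "\<lambda>_. c"])
next
  case (add f g)
  then show ?case
    by (simp add: distrib_left low_degree.add)
qed

text \<open>At most the coordinate \<open>y\<close> becomes non-constant. This is the cost of one
  query.\<close>

lemma low_degree_indicator:
  assumes "low_degree n f"
  shows "low_degree (Suc n) (\<lambda>A. of_bool (A y = u) * f A)"
  using assms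
proof induction
  case (product \<phi>)
  let ?\<phi> = "\<phi>(y := \<lambda>b. of_bool (b = u) * \<phi> y b)"
  have "card {x. \<exists>a b. ?\<phi> x a \<noteq> ?\<phi> x b} \<le> card (insert y {x. \<exists>a b. \<phi> x a \<noteq> \<phi> x b})"
    by (intro card_mono) auto
  also have "\<dots> \<le> Suc n"
    using product card_insert_le_m1[of "Suc n" "{x. \<exists>a b. \<phi> x a \<noteq> \<phi> x b}" y] by simp
  finally have "low_degree (Suc n) (\<lambda>A. \<Prod>x\<in>UNIV. ?\<phi> x (A x))"
    by (rule low_degree.product)
  then show ?case
    by (simp only: prod_fun_upd_mult[of \<phi> y "\<lambda>b. of_bool (b = u)"])
next
  case (add f g)
  then show ?case
    by (simp add: distrib_left low_degree.add)
qed

lemma low_degree_const: "low_degree n (\<lambda>A. c)"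
proof -
  have "low_degree n (\<lambda>A. c * (\<Prod>x\<in>UNIV. (\<lambda>_ _. 1) x (A x)))"
    by (intro low_degree_scale low_degree.product) simp
  then show ?thesis by simp
qed

lemma low_degree_sum:
  assumes "finite I" "\<And>i. i \<in> I \<Longrightarrow> low_degree n (f i)"
  shows "low_degree n (\<lambda>A. \<Sum>i\<in>I. f i A)"
  using assms by (induction I) (auto intro: low_degree.add low_degree_const)

text \<open>Each \<open>proj_kernel Y S A\<close> varies only with the coordinates in
  \<open>S\<close>. Hence the rows of the kernel lie in the space that it reproduces.\<close>

lemma low_degree_low_kernel: "low_degree n (\<lambda>B. of_real (low_kernel n Y A B))"
proof -
  have "low_degree n (\<lambda>B. of_real (proj_kernel Y S A B))" if S: "S \<subseteq> Y" "card S \<le> n" for S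
  proof -
    define \<phi> where "\<phi> = (\<lambda>x b. if x \<in> Y then complex_of_real (coord_kernel (x \<in> S) (A x) b) else 1)"
    have "{x. \<exists>a b. \<phi> x a \<noteq> \<phi> x b} \<subseteq> S"
      by (auto simp: \<phi>_def coord_kernel_def split: if_splits)
    then have "card {x. \<exists>a b. \<phi> x a \<noteq> \<phi> x b} \<le> n"
      using S card_mono[of S] by (meson finite le_trans)
    then have "low_degree n (\<lambda>B. \<Prod>x\<in>UNIV. \<phi> x (B x))"
      by (rule low_degree.product)
    moreover have "(\<Prod>x\<in>UNIV. \<phi> x (B x)) = of_real (proj_kernel Y S A B)" for B
      unfolding \<phi>_def proj_kernel_def by (simp add: prod.If_cases)
    ultimately show ?thesis by simp
  qed
  then show ?thesis
    unfolding low_kernel_def of_real_sum by (intro low_degree_sum) auto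
qed

text \<open>Only sets \<open>S\<close> of coordinates on which a product depends contribute, because every other
  mean-zero part vanishes; so the bound on \<open>card S\<close> in \<open>low_kernel\<close> may be dropped, and the sum
  over all \<open>S\<close> multiplies out to the identity.\<close>

lemma low_kernel_reproducing:
  fixes f :: "('x::finite \<Rightarrow> 'g::finite) \<Rightarrow> complex"
  assumes "low_degree n f"
  shows "(\<Sum>B | \<forall>x. x \<notin> Y \<longrightarrow> B x = A x. of_real (low_kernel n Y A B) * f B) = f A"
  using assms
proof induction
  case (product \<phi>)
  \<comment> \<open>Each factor is split at \<open>A x\<close> into its mean \<open>m x\<close> and
    its deviation \<open>d x\<close>; the deviation of a constant factor vanishes.\<close>
  define m where "m x = (\<Sum>b\<in>UNIV. \<phi> x b) / of_nat CARD('g)" for x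
  define d where "d x = \<phi> x (A x) - m x" for x
  let ?R = "{B. \<forall>x. x \<notin> Y \<longrightarrow> B x = A x}"
  let ?C = "{x. \<exists>a b. \<phi> x a \<noteq> \<phi> x b}"
  have d0: "d x = 0" if "x \<notin> ?C" for x
  proof -
    have "\<phi> x = (\<lambda>b. \<phi> x (A x))"
      using that by auto
    then have "m x = (\<Sum>b\<in>(UNIV::'g set). \<phi> x (A x)) / of_nat CARD('g)"
      unfolding m_def by metis
    then show ?thesis by (simp add: d_def)
  qed
  have contribution: "(\<Sum>B\<in>?R. of_real (proj_kernel Y S A B) * (\<Prod>x\<in>UNIV. \<phi> x (B x))) =
      ((\<Prod>x\<in>S. d x) * (\<Prod>x\<in>Y-S. m x)) * (\<Prod>x\<in>-Y. \<phi> x (A x))" if "S \<subseteq> Y" for S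
  proof -
    have "(\<Sum>B\<in>?R. of_real (proj_kernel Y S A B) * (\<Prod>x\<in>UNIV. \<phi> x (B x))) =
        (\<Sum>B\<in>?R. \<Prod>x\<in>UNIV.
          (if x \<in> Y then of_real (coord_kernel (x \<in> S) (A x) (B x)) else 1) * \<phi> x (B x))"
      by (simp add: prod.distrib prod.If_cases proj_kernel_def)
    also have "\<dots> = (\<Prod>x\<in>UNIV. if x \<in> Y then (if x \<in> S then d x else m x) else \<phi> x (A x))"
      by (subst sum_prod_agree_off) (auto simp: sum_coord_kernel d_def m_def intro!: prod.cong)
    also have "\<dots> = (\<Prod>x\<in>Y. if x \<in> S then d x else m x) * (\<Prod>x\<in>-Y. \<phi> x (A x))"
      by (simp add: prod.If_cases)
    also have "(\<Prod>x\<in>Y. if x \<in> S then d x else m x) = (\<Prod>x\<in>S. d x) * (\<Prod>x\<in>Y-S. m x)"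
      using that by (simp add: prod.If_cases Int_absorb1 Diff_eq)
    finally show ?thesis .
  qed
  have "(\<Sum>B\<in>?R. of_real (low_kernel n Y A B) * (\<Prod>x\<in>UNIV. \<phi> x (B x))) =
      (\<Sum>S | S \<subseteq> Y \<and> card S \<le> n. \<Sum>B\<in>?R. of_real (proj_kernel Y S A B) * (\<Prod>x\<in>UNIV. \<phi> x (B x)))"
    unfolding low_kernel_def of_real_sum sum_distrib_right by (rule sum.swap)
  also have "\<dots> = (\<Sum>S | S \<subseteq> Y \<and> card S \<le> n. (\<Prod>x\<in>S. d x) * (\<Prod>x\<in>Y-S. m x)) * (\<Prod>x\<in>-Y. \<phi> x (A x))"
    by (simp add: contribution sum_distrib_right)
  also have "(\<Sum>S | S \<subseteq> Y \<and> card S \<le> n. (\<Prod>x\<in>S. d x) * (\<Prod>x\<in>Y-S. m x)) =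
      (\<Sum>S\<in>Pow Y. (\<Prod>x\<in>S. d x) * (\<Prod>x\<in>Y-S. m x))"
  proof (rule sum.mono_neutral_left)
    show "\<forall>S\<in>Pow Y - {S. S \<subseteq> Y \<and> card S \<le> n}. (\<Prod>x\<in>S. d x) * (\<Prod>x\<in>Y-S. m x) = 0"
    proof
      fix S assume "S \<in> Pow Y - {S. S \<subseteq> Y \<and> card S \<le> n}"
      then have "card S > n" by auto
      then have "\<not> S \<subseteq> ?C"
        using product card_mono[of ?C S] by (meson finite leD le_trans)
      then obtain x where "x \<in> S" "d x = 0"
        using d0 by blast
      then have "(\<Prod>x\<in>S. d x) = 0"
        by (intro prod_zero) auto
      then show "(\<Prod>x\<in>S. d x) * (\<Prod>x\<in>Y-S. m x) = 0" by simp
    qed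
  qed auto
  also have "\<dots> = (\<Prod>x\<in>Y. d x + m x)"
    by (simp add: prod_add)
  also have "\<dots> * (\<Prod>x\<in>-Y. \<phi> x (A x)) = (\<Prod>x\<in>UNIV. \<phi> x (A x))"
    by (subst prod.subset_diff[of Y UNIV]) (auto simp: d_def Compl_eq_Diff_UNIV mult.commute)
  finally show ?case .
next
  case (add f g)
  then show ?case
    by (simp add: distrib_left sum.distrib)
qed

text \<open>The reproducing property is applied to the row \<open>low_kernel n Y A\<close>
  itself.\<close>

lemma sum_low_kernel_square:
  fixes A :: "'x::finite \<Rightarrow> 'g::finite"
  shows "(\<Sum>B | \<forall>x. x \<notin> Y \<longrightarrow> B x = A x. (low_kernel n Y A B)\<^sup>2) = low_kernel n Y A A"
proof -
  have "complex_of_real (\<Sum>B | \<forall>x. x \<notin> Y \<longrightarrow> B x = A x. (low_kernel n Y A B)\<^sup>2) =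
      (\<Sum>B | \<forall>x. x \<notin> Y \<longrightarrow> B x = A x. of_real (low_kernel n Y A B) * of_real (low_kernel n Y A B))"
    by (simp add: power2_eq_square)
  also have "\<dots> = of_real (low_kernel n Y A A)"
    by (rule low_kernel_reproducing[OF low_degree_low_kernel])
  finally show ?thesis
    using of_real_eq_iff by blast
qed

section \<open>Diagonal values of the kernel\<close>

lemma sum_subsets_by_card:
  fixes f :: "nat \<Rightarrow> 'c::comm_semiring_1"
  assumes "finite Y"
  shows "(\<Sum>S | S \<subseteq> Y \<and> card S \<le> n. f (card S)) = (\<Sum>i=0..n. of_nat (card Y choose i) * f i)"
proof -
  have "(\<Sum>S | S \<subseteq> Y \<and> card S \<le> n. f (card S)) =
      (\<Sum>i=0..n. \<Sum>S | S \<in> {S. S \<subseteq> Y \<and> card S \<le> n} \<and> card S = i. f (card S))"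
    using assms by (intro sum.group[symmetric]) auto
  also have "\<dots> = (\<Sum>i=0..n. \<Sum>S | S \<subseteq> Y \<and> card S = i. f i)"
    by (intro sum.cong) auto
  also have "\<dots> = (\<Sum>i=0..n. of_nat (card Y choose i) * f i)"
    using assms by (simp add: n_subsets)
  finally show ?thesis .
qed

text \<open>With N the order of the group, a coordinate in \<open>S\<close> contributes (N - 1)/N
  and any other coordinate of \<open>Y\<close> contributes 1/N, whatever the tables are
  there.\<close>

lemma proj_kernel_agree:
  fixes A B :: "'x \<Rightarrow> 'g::finite"
  assumes "finite Y" "S \<subseteq> Y" "\<And>x. x \<in> S \<Longrightarrow> A x = B x"
  shows "proj_kernel Y S A B = (real CARD('g) - 1) ^ card S / real CARD('g) ^ card Y"
proof -
  have fin: "finite S" using assms finite_subset by blast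
  have "proj_kernel Y S A B = (\<Prod>x\<in>Y. (if x \<in> S then real CARD('g) - 1 else 1) / real CARD('g))"
    unfolding proj_kernel_def using assms(3)
    by (intro prod.cong) (auto simp: coord_kernel_def diff_divide_distrib)
  also have "\<dots> = (real CARD('g) - 1) ^ card S / real CARD('g) ^ card Y"
    using assms fin by (simp add: prod_dividef prod.If_cases Int_absorb1)
  finally show ?thesis .
qed

text \<open>The sum is the dimension of the space of functions of degree at most \<open>n\<close> on
  \<open>Y\<close>, that is, the trace of the projection; it is spread evenly over the tables on
  \<open>Y\<close>.\<close>

lemma low_kernel_diag:
  fixes A :: "'x::finite \<Rightarrow> 'g::finite"
  shows "low_kernel n Y A A =
    1 / real CARD('g) ^ card Y * (\<Sum>i=0..n. real (card Y choose i) * (real CARD('g) - 1) ^ i)"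
proof -
  have "low_kernel n Y A A =
      (\<Sum>S | S \<subseteq> Y \<and> card S \<le> n. (real CARD('g) - 1) ^ card S) / real CARD('g) ^ card Y"
    by (simp add: low_kernel_def proj_kernel_agree sum_divide_distrib)
  then show ?thesis
    by (simp add: sum_subsets_by_card)
qed

section \<open>States and measurements\<close>

definition sq_norm :: "'b set \<Rightarrow> 'b state \<Rightarrow> real" where
  "sq_norm B \<psi> = (\<Sum>i\<in>B. (cmod (\<psi> i))\<^sup>2)"

definition sesq_form :: "'b set \<Rightarrow> 'b operator \<Rightarrow> 'b state \<Rightarrow> 'b state \<Rightarrow> complex" where
  "sesq_form B P \<phi> \<psi> = (\<Sum>i\<in>B. \<Sum>j\<in>B. cnj (\<phi> i) * P i j * \<psi> j)"

lemma quad_form_sesq: "quad_form B P \<psi> = sesq_form B P \<psi> \<psi>"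
  by (simp add: quad_form_def sesq_form_def)

lemma sesq_form_sum_right:
  "sesq_form B P \<phi> (\<lambda>j. \<Sum>n\<in>I. c n * \<psi> n j) = (\<Sum>n\<in>I. c n * sesq_form B P \<phi> (\<psi> n))"
proof -
  have "sesq_form B P \<phi> (\<lambda>j. \<Sum>n\<in>I. c n * \<psi> n j) =
      (\<Sum>i\<in>B. \<Sum>n\<in>I. \<Sum>j\<in>B. cnj (\<phi> i) * P i j * (c n * \<psi> n j))"
    unfolding sesq_form_def sum_distrib_left by (intro sum.cong refl sum.swap)
  also have "\<dots> = (\<Sum>n\<in>I. \<Sum>i\<in>B. \<Sum>j\<in>B. cnj (\<phi> i) * P i j * (c n * \<psi> n j))"
    by (rule sum.swap)
  also have "\<dots> = (\<Sum>n\<in>I. c n * sesq_form B P \<phi> (\<psi> n))"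
    by (simp add: sesq_form_def sum_distrib_left algebra_simps)
  finally show ?thesis .
qed

lemma sesq_form_sum_left:
  "sesq_form B P (\<lambda>i. \<Sum>n\<in>I. c n * \<phi> n i) \<psi> = (\<Sum>n\<in>I. cnj (c n) * sesq_form B P (\<phi> n) \<psi>)"
proof -
  have "sesq_form B P (\<lambda>i. \<Sum>n\<in>I. c n * \<phi> n i) \<psi> =
      (\<Sum>i\<in>B. \<Sum>n\<in>I. \<Sum>j\<in>B. cnj (c n * \<phi> n i) * P i j * \<psi> j)"
    unfolding sesq_form_def cnj_sum sum_distrib_right by (intro sum.cong refl sum.swap)
  also have "\<dots> = (\<Sum>n\<in>I. \<Sum>i\<in>B. \<Sum>j\<in>B. cnj (c n * \<phi> n i) * P i j * \<psi> j)"
    by (rule sum.swap)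
  also have "\<dots> = (\<Sum>n\<in>I. cnj (c n) * sesq_form B P (\<phi> n) \<psi>)"
    by (simp add: sesq_form_def sum_distrib_left algebra_simps)
  finally show ?thesis .
qed

lemma quad_form_diff:
  fixes t :: real
  shows "quad_form B P (\<lambda>i. \<phi> i - of_real t * \<psi> i) =
    quad_form B P \<phi> - of_real t * (sesq_form B P \<phi> \<psi> + sesq_form B P \<psi> \<phi>) + (of_real t)\<^sup>2 * quad_form B P \<psi>"
  by (simp add: quad_form_def sesq_form_def sum_distrib_left sum_subtractf sum.distrib
      algebra_simps power2_eq_square)

lemma psd_on_Re: "psd_on B P \<Longrightarrow> 0 \<le> Re (quad_form B P \<psi>)"
  by (auto simp: psd_on_def complex_nonneg_Reals_iff)

text \<open>With \<chi> the combination on the left and \<open>c\<close> the sum of the squared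
  coefficients, the form is nonnegative at every residual
  \<open>\<psi> n - (t n / c) \<chi>\<close>. Summed over \<open>n\<close>, the cross terms give
  -2/c and the square terms 1/c times the form at \<chi>.\<close>

lemma psd_on_cauchy_schwarz:
  fixes t :: "'i \<Rightarrow> real"
  assumes "psd_on B P" and "finite I"
  shows "Re (quad_form B P (\<lambda>j. \<Sum>n\<in>I. of_real (t n) * \<psi> n j)) \<le>
    (\<Sum>n\<in>I. (t n)\<^sup>2) * (\<Sum>n\<in>I. Re (quad_form B P (\<psi> n)))"
proof -
  define c where "c = (\<Sum>n\<in>I. (t n)\<^sup>2)"
  define \<chi> where "\<chi> = (\<lambda>j. \<Sum>n\<in>I. of_real (t n) * \<psi> n j)"
  have Q: "quad_form B P \<chi> = (\<Sum>n\<in>I. of_real (t n) * sesq_form B P \<chi> (\<psi> n))"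
    "quad_form B P \<chi> = (\<Sum>n\<in>I. of_real (t n) * sesq_form B P (\<psi> n) \<chi>)"
    unfolding quad_form_sesq by (subst (2) \<chi>_def, rule sesq_form_sum_right)
      (subst (1) \<chi>_def, subst sesq_form_sum_left, simp)
  show ?thesis
  proof (cases "c = 0")
    case True
    then have "t n = 0" if "n \<in> I" for n
      using that assms(2) by (simp add: c_def sum_nonneg_eq_0_iff)
    then have "\<chi> = (\<lambda>j. 0)"
      by (simp add: \<chi>_def)
    then show ?thesis
      using True by (simp add: \<chi>_def c_def quad_form_def)
  next
    case False
    then have c: "c > 0"
      using sum_nonneg[of I "\<lambda>n. (t n)\<^sup>2"] by (simp add: c_def less_le)
    have "0 \<le> (\<Sum>n\<in>I. Re (quad_form B P (\<lambda>i. \<psi> n i - of_real (t n / c) * \<chi> i)))"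
      by (intro sum_nonneg psd_on_Re assms(1))
    also have "\<dots> = Re (\<Sum>n\<in>I. quad_form B P (\<psi> n)
        - (of_real (t n) * sesq_form B P (\<psi> n) \<chi> + of_real (t n) * sesq_form B P \<chi> (\<psi> n)) / of_real c
        + of_real ((t n)\<^sup>2) * quad_form B P \<chi> / of_real (c\<^sup>2))"
      unfolding quad_form_diff Re_sum by (simp add: distrib_left add_divide_distrib power_divide)
    also have "\<dots> = Re ((\<Sum>n\<in>I. quad_form B P (\<psi> n))
        - (quad_form B P \<chi> + quad_form B P \<chi>) / of_real c
        + of_real c * quad_form B P \<chi> / of_real (c\<^sup>2))"
      unfolding sum.distrib sum_subtractf sum_divide_distrib[symmetric] Q[symmetric]
        sum_distrib_right[symmetric] of_real_sum[symmetric] c_def[symmetric] ..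
    also have "\<dots> = Re ((\<Sum>n\<in>I. quad_form B P (\<psi> n)) - quad_form B P \<chi> / of_real c)"
      using c by (intro arg_cong[of _ _ Re]) (simp add: field_simps power2_eq_square)
    finally have "Re (quad_form B P \<chi>) / c \<le> (\<Sum>n\<in>I. Re (quad_form B P (\<psi> n)))"
      by simp
    then show ?thesis
      using c by (simp add: \<chi>_def c_def field_simps)
  qed
qed

section \<open>Norms under gates and queries, and total probability\<close>

lemma sq_norm_complex: "complex_of_real (sq_norm B \<psi>) = (\<Sum>i\<in>B. cnj (\<psi> i) * \<psi> i)"
  unfolding sq_norm_def of_real_sum
  by (intro sum.cong refl) (simp add: complex_norm_square mult.commute del: of_real_power)

lemma sq_norm_unitary:
  assumes "finite B" "unitary_on B U"
  shows "sq_norm B (apply_op B U \<psi>) = sq_norm B \<psi>"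
proof -
  have "(\<Sum>l\<in>B. cnj (apply_op B U \<psi> l) * apply_op B U \<psi> l) =
      (\<Sum>l\<in>B. \<Sum>i\<in>B. \<Sum>j\<in>B. cnj (\<psi> i) * (cnj (U l i) * U l j) * \<psi> j)"
    unfolding apply_op_def cnj_sum sum_product by (simp add: mult_ac)
  also have "\<dots> = (\<Sum>i\<in>B. \<Sum>l\<in>B. \<Sum>j\<in>B. cnj (\<psi> i) * (cnj (U l i) * U l j) * \<psi> j)"
    by (rule sum.swap)
  also have "\<dots> = (\<Sum>i\<in>B. \<Sum>j\<in>B. \<Sum>l\<in>B. cnj (\<psi> i) * (cnj (U l i) * U l j) * \<psi> j)"
    by (intro sum.cong refl sum.swap)
  also have "\<dots> = (\<Sum>i\<in>B. \<Sum>j\<in>B. cnj (\<psi> i) * of_bool (i = j) * \<psi> j)"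
    using assms(2) by (simp add: unitary_on_def sum_distrib_left[symmetric] sum_distrib_right[symmetric])
  also have "\<dots> = (\<Sum>i\<in>B. \<Sum>j\<in>B. if i = j then cnj (\<psi> i) * \<psi> j else 0)"
    by (intro sum.cong) auto
  also have "\<dots> = (\<Sum>i\<in>B. cnj (\<psi> i) * \<psi> i)"
    using assms(1) by simp
  finally show ?thesis
    unfolding sq_norm_complex[symmetric] of_real_eq_iff .
qed

lemma finite_qbasis [simp]: "finite (qbasis d :: ('x::finite \<times> 'g::finite \<times> nat) set)"
  by (simp add: qbasis_def)

lemma apply_query_op:
  fixes A :: "'x::finite \<Rightarrow> 'g::{finite, ab_group_add}"
  assumes "z < d"
  shows "apply_op (qbasis d) (query_op A) \<psi> (x, g, z) = \<psi> (x, g - A x, z)"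
proof -
  have "apply_op (qbasis d) (query_op A) \<psi> (x, g, z) =
      (\<Sum>j\<in>qbasis d. if j = (x, g - A x, z) then \<psi> j else 0)"
    unfolding apply_op_def by (intro sum.cong refl) (auto simp: query_op_def algebra_simps)
  also have "\<dots> = \<psi> (x, g - A x, z)"
    using assms by (simp add: qbasis_def)
  finally show ?thesis .
qed

lemma sq_norm_query_op:
  fixes A :: "'x::finite \<Rightarrow> 'g::{finite, ab_group_add}"
  shows "sq_norm (qbasis d) (apply_op (qbasis d) (query_op A) \<psi>) = sq_norm (qbasis d) \<psi>"
proof -
  have "sq_norm (qbasis d) (apply_op (qbasis d) (query_op A) \<psi>) =
      (\<Sum>(x, g, z)\<in>qbasis d. (cmod (\<psi> (x, g - A x, z)))\<^sup>2)"
    unfolding sq_norm_def by (intro sum.cong) (auto simp: qbasis_def apply_query_op[unfolded qbasis_def])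
  also have "\<dots> = (\<Sum>i\<in>qbasis d. (cmod (\<psi> i))\<^sup>2)"
    by (rule sum.reindex_bij_witness[of _ "\<lambda>(x, g, z). (x, g + A x, z)" "\<lambda>(x, g, z). (x, g - A x, z)"])
      (auto simp: qbasis_def)
  finally show ?thesis
    by (simp add: sq_norm_def)
qed

lemma sum_povm:
  assumes "finite B" "povm_on B R E"
  shows "(\<Sum>r\<in>R. Re (quad_form B (E r) \<psi>)) = sq_norm B \<psi>"
proof -
  have "(\<Sum>r\<in>R. quad_form B (E r) \<psi>) = (\<Sum>i\<in>B. \<Sum>r\<in>R. \<Sum>j\<in>B. cnj (\<psi> i) * E r i j * \<psi> j)"
    unfolding quad_form_def by (rule sum.swap)
  also have "\<dots> = (\<Sum>i\<in>B. \<Sum>j\<in>B. \<Sum>r\<in>R. cnj (\<psi> i) * E r i j * \<psi> j)"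
    by (intro sum.cong refl sum.swap)
  also have "\<dots> = (\<Sum>i\<in>B. \<Sum>j\<in>B. if i = j then cnj (\<psi> i) * \<psi> j else 0)"
    using assms(2) unfolding povm_on_def sum_distrib_left[symmetric] sum_distrib_right[symmetric]
    by (intro sum.cong) auto
  also have "\<dots> = of_real (sq_norm B \<psi>)"
    using assms(1) by (simp add: sq_norm_complex)
  finally show ?thesis
    by (simp flip: Re_sum)
qed

section \<open>The upper bound\<close>

lemma sq_norm_state_after:
  fixes a :: "('x::finite, 'g::{finite, ab_group_add}) qalg"
  assumes "query_algorithm q k a" "n \<le> q"
  shows "sq_norm (qbasis (wdim a)) (state_after a A n) = 1"
  using assms(2)
proof (induction n)
  case 0
  then show ?case
    using assms(1) by (simp add: query_algorithm_def unit_state_on_def sq_norm_def)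
next
  case (Suc n)
  moreover have "unitary_on (qbasis (wdim a)) (gate a n)"
    using assms(1) Suc.prems by (simp add: query_algorithm_def)
  ultimately show ?case
    by (simp add: sq_norm_unitary sq_norm_query_op)
qed

text \<open>After a query the amplitude at \<open>g\<close> is the earlier one at
  \<open>g - A x\<close>. Splitting by the value \<open>u\<close> of \<open>A x\<close> turns it
  into indicators times earlier amplitudes, so the degree grows by one; gates do not depend on
  \<open>A\<close>.\<close>

lemma low_degree_state_after:
  fixes a :: "('x::finite, 'g::{finite, ab_group_add}) qalg"
  assumes "i \<in> qbasis (wdim a)"
  shows "low_degree n (\<lambda>A. state_after a A n i)"
  using assms
proof (induction n arbitrary: i)
  case 0
  then show ?case
    by (simp add: low_degree_const)
next
  case (Suc n)
  have "low_degree (Suc n) (\<lambda>A. apply_op (qbasis (wdim a)) (query_op A) (state_after a A n) j)"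
    if j: "j \<in> qbasis (wdim a)" for j
  proof -
    obtain x g z where xgz: "j = (x, g, z)" "z < wdim a"
      using j by (auto simp: qbasis_def)
    have "low_degree (Suc n) (\<lambda>A. \<Sum>u\<in>UNIV. of_bool (A x = u) * state_after a A n (x, g - u, z))"
      using xgz by (intro low_degree_sum low_degree_indicator Suc.IH) (auto simp: qbasis_def)
    moreover have "apply_op (qbasis (wdim a)) (query_op A) (state_after a A n) j =
        (\<Sum>u\<in>UNIV. of_bool (A x = u) * state_after a A n (x, g - u, z))" for A
    proof -
      have "(\<Sum>u\<in>UNIV. of_bool (A x = u) * state_after a A n (x, g - u, z)) =
          (\<Sum>u\<in>UNIV. if u = A x then state_after a A n (x, g - u, z) else 0)"
        by (intro sum.cong) auto
      then show ?thesis
        using xgz by (simp add: apply_query_op)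
    qed
    ultimately show ?thesis by simp
  qed
  then show ?case
    unfolding state_after.simps apply_op_def[of _ "gate a n"]
    by (intro low_degree_sum low_degree_scale) auto
qed

lemma low_kernel_diag_nonneg: "0 \<le> low_kernel n Y A A"
  unfolding sum_low_kernel_square[symmetric] by (intro sum_nonneg) auto

lemma sum_outcome_prob_le:
  fixes a :: "('x::finite, 'g::{finite, ab_group_add}) qalg"
  assumes alg: "query_algorithm q k a" and r: "r \<in> outcomes k" "distinct (map fst r)"
  defines "c \<equiv> 1 / real CARD('g) ^ k * (\<Sum>i=0..q. real (k choose i) * (real CARD('g) - 1) ^ i)"
  shows "(\<Sum>A | correct_output A r. outcome_prob q a A r) \<le> c * (\<Sum>A\<in>UNIV. outcome_prob q a A r)"
proof -
  let ?B = "qbasis (wdim a)"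
  define Y where "Y = fst ` set r"
  let ?R = "\<lambda>A. {B. \<forall>x. x \<notin> Y \<longrightarrow> B x = A x}"
  have "card Y = k"
    using r distinct_card[of "map fst r"] by (simp add: Y_def outcomes_def)
  then have c: "low_kernel q Y A A = c" for A :: "'x \<Rightarrow> 'g"
    by (simp add: low_kernel_diag c_def)
  then have "c \<ge> 0"
    using low_kernel_diag_nonneg by metis
  have psd: "psd_on ?B (meas a r)"
    using alg r(1) by (simp add: query_algorithm_def povm_on_def)
  have nonneg: "0 \<le> outcome_prob q a A r" for A
    unfolding outcome_prob_def by (rule psd_on_Re[OF psd])
  have bound: "outcome_prob q a A r \<le> c * (\<Sum>B\<in>?R A. outcome_prob q a B r)" for A
  proof -
    \<comment> \<open>Reproducing every amplitude writes the state at \<open>A\<close> as a real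
      combination of the states at oracles that agree with \<open>A\<close> off
      \<open>Y\<close>.\<close>
    have "quad_form ?B (meas a r) (state_after a A q) = quad_form ?B (meas a r)
        (\<lambda>i. \<Sum>B\<in>?R A. of_real (low_kernel q Y A B) * state_after a B q i)"
      unfolding quad_form_def
      by (intro sum.cong refl arg_cong2[of _ _ _ _ "(*)"] arg_cong[of _ _ cnj]
          low_kernel_reproducing[symmetric] low_degree_state_after)
    then have "outcome_prob q a A r \<le>
        (\<Sum>B\<in>?R A. (low_kernel q Y A B)\<^sup>2) * (\<Sum>B\<in>?R A. outcome_prob q a B r)"
      unfolding outcome_prob_def by (simp add: psd_on_cauchy_schwarz[OF psd])
    then show ?thesis
      by (simp add: sum_low_kernel_square c)
  qed
  have "(\<Sum>A | correct_output A r. outcome_prob q a A r) \<le>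
      (\<Sum>A | correct_output A r. c * (\<Sum>B\<in>?R A. outcome_prob q a B r))"
    by (intro sum_mono bound)
  also have "\<dots> = c * (\<Sum>B\<in>(\<Union>A\<in>{A. correct_output A r}. ?R A). outcome_prob q a B r)"
  proof -
    \<comment> \<open>The outcome determines a correct oracle on \<open>Y\<close> and membership in
      its class determines it off \<open>Y\<close>, so no oracle is counted twice.\<close>
    have "?R A \<inter> ?R A' = {}" if "correct_output A r" "correct_output A' r" "A \<noteq> A'" for A A'
    proof (rule ccontr)
      assume "?R A \<inter> ?R A' \<noteq> {}"
      then obtain B where B: "B \<in> ?R A" "B \<in> ?R A'" by blast
      have "A x = A' x" for x
      proof (cases "x \<in> Y")
        case True
        then show ?thesis
          using that(1,2) by (fastforce simp: Y_def correct_output_def)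
      next
        case False
        then show ?thesis
          using B by simp
      qed
      then show False
        using that(3) by blast
    qed
    then show ?thesis
      by (subst sum.UNION_disjoint) (auto simp: sum_distrib_left)
  qed
  also have "\<dots> \<le> c * (\<Sum>A\<in>UNIV. outcome_prob q a A r)"
    using \<open>c \<ge> 0\<close> nonneg by (intro mult_left_mono sum_mono2) auto
  finally show ?thesis .
qed

lemma finite_outcomes [simp]: "finite (outcomes k :: ('x::finite \<times> 'g::finite) list set)"
  using finite_lists_length_eq[of "UNIV :: ('x \<times> 'g) set" k] by (simp add: outcomes_def)

text \<open>Exchanging the sums allows the bound to be used for each outcome separately; afterwards
  the outcome probabilities add up to one at every oracle.\<close>

lemma success_prob_le:
  fixes a :: "('x::finite, 'g::{finite, ab_group_add}) qalg"
  assumes "query_algorithm q k a"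
  shows "success_prob q k a \<le>
    1 / real CARD('g) ^ k * (\<Sum>i=0..q. real (k choose i) * (real CARD('g) - 1) ^ i)"
    (is "_ \<le> ?c")
proof -
  have povm: "povm_on (qbasis (wdim a)) (outcomes k) (meas a)"
    using assms by (simp add: query_algorithm_def)
  have c: "?c \<ge> 0"
    by (intro mult_nonneg_nonneg sum_nonneg) auto
  have nonneg: "0 \<le> outcome_prob q a A r" if "r \<in> outcomes k" for A r
    unfolding outcome_prob_def using povm that by (intro psd_on_Re) (simp add: povm_on_def)
  have "(\<Sum>A\<in>UNIV. \<Sum>r | r \<in> outcomes k \<and> correct_output A r. outcome_prob q a A r) =
      (\<Sum>r\<in>outcomes k. \<Sum>A | correct_output A r. outcome_prob q a A r)"
    using sum.swap_restrict[of "UNIV :: ('x \<Rightarrow> 'g) set" "outcomes k"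
        "outcome_prob q a" correct_output] by simp
  also have "\<dots> \<le> (\<Sum>r\<in>outcomes k. ?c * (\<Sum>A\<in>UNIV. outcome_prob q a A r))"
  proof (intro sum_mono)
    fix r :: "('x \<times> 'g) list" assume r: "r \<in> outcomes k"
    show "(\<Sum>A | correct_output A r. outcome_prob q a A r) \<le> ?c * (\<Sum>A\<in>UNIV. outcome_prob q a A r)"
    proof (cases "distinct (map fst r)")
      case True
      then show ?thesis
        by (rule sum_outcome_prob_le[OF assms r])
    next
      case False
      then have "{A. correct_output A r} = {}"
        by (auto simp: correct_output_def)
      then have "(\<Sum>A | correct_output A r. outcome_prob q a A r) = 0"
        by (simp only: sum.empty)
      also have "\<dots> \<le> ?c * (\<Sum>A\<in>UNIV. outcome_prob q a A r)"
        by (rule mult_nonneg_nonneg[OF c sum_nonneg]) (rule nonneg[OF r])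
      finally show ?thesis .
    qed
  qed
  also have "\<dots> = ?c * (\<Sum>A\<in>UNIV. \<Sum>r\<in>outcomes k. outcome_prob q a A r)"
    unfolding sum_distrib_left[symmetric] by (subst sum.swap) (rule refl)
  also have "(\<Sum>A\<in>(UNIV :: ('x \<Rightarrow> 'g) set). \<Sum>r\<in>outcomes k. outcome_prob q a A r) = real CARD('x \<Rightarrow> 'g)"
    unfolding outcome_prob_def
    by (simp add: sum_povm[OF finite_qbasis povm] sq_norm_state_after[OF assms])
  finally show ?thesis
    unfolding success_prob_def by (subst pos_divide_le_eq) (simp_all add: card_gt_0_iff)
qed

section \<open>Measurements and gates from orthonormal families\<close>

definition inner_on :: "'b set \<Rightarrow> 'b state \<Rightarrow> 'b state \<Rightarrow> complex" where
  "inner_on B \<phi> \<psi> = (\<Sum>i\<in>B. cnj (\<phi> i) * \<psi> i)"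

text \<open>Makes the linearity rules for \<open>sesq_form\<close> available for inner
  products.\<close>

lemma inner_on_sesq:
  assumes "finite B"
  shows "inner_on B \<phi> \<psi> = sesq_form B (\<lambda>i j. of_bool (i = j)) \<phi> \<psi>"
proof -
  have "sesq_form B (\<lambda>i j. of_bool (i = j)) \<phi> \<psi> = (\<Sum>i\<in>B. \<Sum>j\<in>B. if i = j then cnj (\<phi> i) * \<psi> j else 0)"
    unfolding sesq_form_def by (intro sum.cong) auto
  then show ?thesis
    using assms by (simp add: inner_on_def)
qed

text \<open>The vector \<chi> is the projection of \<psi> onto the span of the family. Its inner
  products with \<psi> and with itself all equal \<open>m\<close>, so the residual has squared norm
  \<open>sq_norm B \<psi> - m\<close>.\<close>

lemma bessel_inequality:
  fixes \<eta> :: "'a::finite \<Rightarrow> 'b state"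
  assumes fin: "finite B" and orth: "\<And>a c. inner_on B (\<eta> a) (\<eta> c) = of_bool (a = c)"
  shows "(\<Sum>a\<in>UNIV. (cmod (inner_on B (\<eta> a) \<psi>))\<^sup>2) \<le> sq_norm B \<psi>"
proof -
  let ?I = "\<lambda>i j. of_bool (i = j) :: complex"
  define c where "c a = inner_on B (\<eta> a) \<psi>" for a
  define \<chi> where "\<chi> = (\<lambda>i. \<Sum>a\<in>UNIV. c a * \<eta> a i)"
  define m where "m = (\<Sum>a\<in>UNIV. (cmod (c a))\<^sup>2)"
  have m: "of_real m = (\<Sum>a\<in>UNIV. cnj (c a) * c a)"
    unfolding m_def of_real_sum
    by (intro sum.cong refl) (simp add: complex_norm_square mult.commute del: of_real_power)
  have \<chi>\<psi>: "inner_on B \<chi> \<psi> = of_real m"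
    unfolding inner_on_sesq[OF fin] \<chi>_def sesq_form_sum_left m
    by (simp add: c_def inner_on_sesq[OF fin])
  have "inner_on B \<psi> \<chi> = cnj (inner_on B \<chi> \<psi>)"
    by (simp add: inner_on_def mult.commute)
  then have \<psi>\<chi>: "inner_on B \<psi> \<chi> = of_real m"
    by (simp add: \<chi>\<psi>)
  have "inner_on B (\<eta> a) \<chi> = c a" for a
  proof -
    have "inner_on B (\<eta> a) \<chi> = (\<Sum>n\<in>UNIV. c n * of_bool (a = n))"
      unfolding orth[symmetric] inner_on_sesq[OF fin] \<chi>_def by (rule sesq_form_sum_right)
    also have "\<dots> = (\<Sum>n\<in>UNIV. if n = a then c n else 0)"
      by (intro sum.cong) auto
    finally show ?thesis by simp
  qed
  then have \<chi>\<chi>: "inner_on B \<chi> \<chi> = of_real m"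
    unfolding inner_on_sesq[OF fin] by (subst (1) \<chi>_def) (simp add: sesq_form_sum_left m)
  \<comment> \<open>The coefficient \<open>of_real 1\<close> gives the residual the shape required
    by \<open>quad_form_diff\<close>.\<close>
  have "of_real (sq_norm B (\<lambda>i. \<psi> i - of_real 1 * \<chi> i)) = complex_of_real (sq_norm B \<psi> - m)"
    unfolding sq_norm_complex inner_on_def[symmetric] inner_on_sesq[OF fin] quad_form_sesq[symmetric]
      quad_form_diff
    by (simp add: quad_form_sesq inner_on_sesq[OF fin, symmetric] \<chi>\<chi> \<chi>\<psi> \<psi>\<chi>)
      (simp add: inner_on_def sq_norm_complex)
  then have "sq_norm B \<psi> - m = sq_norm B (\<lambda>i. \<psi> i - of_real 1 * \<chi> i)"
    by (metis of_real_eq_iff)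
  also have "\<dots> \<ge> 0"
    by (simp add: sq_norm_def sum_nonneg)
  finally show ?thesis
    by (simp add: m_def c_def)
qed

lemma quad_form_rank_one:
  "quad_form B (\<lambda>i j. \<eta> i * cnj (\<eta> j)) \<psi> = of_real ((cmod (inner_on B \<eta> \<psi>))\<^sup>2)"
proof -
  have "quad_form B (\<lambda>i j. \<eta> i * cnj (\<eta> j)) \<psi> = cnj (inner_on B \<eta> \<psi>) * inner_on B \<eta> \<psi>"
    unfolding quad_form_def inner_on_def cnj_sum sum_product by (simp add: mult_ac)
  then show ?thesis
    by (simp add: complex_norm_square mult.commute del: of_real_power)
qed

lemma quad_form_sum_op: "quad_form B (\<lambda>i j. \<Sum>a\<in>I. P a i j) \<psi> = (\<Sum>a\<in>I. quad_form B (P a) \<psi>)"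
proof -
  have "quad_form B (\<lambda>i j. \<Sum>a\<in>I. P a i j) \<psi> =
      (\<Sum>i\<in>B. \<Sum>a\<in>I. \<Sum>j\<in>B. cnj (\<psi> i) * P a i j * \<psi> j)"
    unfolding quad_form_def sum_distrib_left sum_distrib_right by (intro sum.cong refl sum.swap)
  also have "\<dots> = (\<Sum>a\<in>I. quad_form B (P a) \<psi>)"
    unfolding quad_form_def by (rule sum.swap)
  finally show ?thesis .
qed

text \<open>The projection onto the orthogonal complement of the family is added to the outcome \<open>r\<^sub>0\<close>.\<close>

lemma orthonormal_povm:
  fixes \<eta> :: "'a::finite \<Rightarrow> 'b state"
  assumes fin: "finite B" "finite R"
    and orth: "\<And>a c. inner_on B (\<eta> a) (\<eta> c) = of_bool (a = c)"
    and R: "range f \<subseteq> R" "r\<^sub>0 \<in> R"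
  obtains E where "povm_on B R E"
    and "\<And>r \<psi>. (\<Sum>a | f a = r. (cmod (inner_on B (\<eta> a) \<psi>))\<^sup>2) \<le> Re (quad_form B (E r) \<psi>)"
proof
  define P where "P a i j = \<eta> a i * cnj (\<eta> a j)" for a i j
  define E where "E r i j = (\<Sum>a | f a = r. P a i j)
    + of_bool (r = r\<^sub>0) * (of_bool (i = j) - (\<Sum>a\<in>UNIV. P a i j))" for r i j
  define w where "w a \<psi> = (cmod (inner_on B (\<eta> a) \<psi>))\<^sup>2" for a \<psi>
  have P: "quad_form B (P a) \<psi> = of_real (w a \<psi>)" for a \<psi>
    unfolding P_def w_def by (rule quad_form_rank_one)
  have E: "quad_form B (E r) \<psi> = of_real ((\<Sum>a | f a = r. w a \<psi>)
      + of_bool (r = r\<^sub>0) * (sq_norm B \<psi> - (\<Sum>a\<in>UNIV. w a \<psi>)))" for r \<psi>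
  proof -
    have id: "quad_form B (\<lambda>i j. of_bool (i = j)) \<psi> = of_real (sq_norm B \<psi>)"
      unfolding sq_norm_complex quad_form_sesq inner_on_sesq[OF fin(1), symmetric] inner_on_def ..
    have "quad_form B (E r) \<psi> = quad_form B (\<lambda>i j. \<Sum>a | f a = r. P a i j) \<psi>
        + of_bool (r = r\<^sub>0) * (quad_form B (\<lambda>i j. of_bool (i = j)) \<psi>
            - quad_form B (\<lambda>i j. \<Sum>a\<in>UNIV. P a i j) \<psi>)"
      unfolding quad_form_def E_def
      by (simp only: distrib_left distrib_right left_diff_distrib right_diff_distrib
          sum.distrib sum_subtractf sum_distrib_left mult_ac)
    then show ?thesis
      by (simp add: id quad_form_sum_op P)
  qed
  have nonneg: "0 \<le> of_bool (r = r\<^sub>0) * (sq_norm B \<psi> - (\<Sum>a\<in>UNIV. w a \<psi>))" for r \<psi>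
    using bessel_inequality[OF fin(1) orth] by (simp add: w_def)
  show "(\<Sum>a | f a = r. (cmod (inner_on B (\<eta> a) \<psi>))\<^sup>2) \<le> Re (quad_form B (E r) \<psi>)" for r \<psi>
    using nonneg[of r \<psi>] unfolding E by (simp add: w_def)
  have "psd_on B (E r)" for r
    unfolding psd_on_def E nonneg_Reals_of_real_iff
    using nonneg by (intro allI add_nonneg_nonneg sum_nonneg) (simp_all add: w_def)
  moreover have "(\<Sum>r\<in>R. E r i j) = of_bool (i = j)" for i j
  proof -
    have "(\<Sum>r\<in>R. \<Sum>a | f a = r. P a i j) = (\<Sum>a\<in>UNIV. P a i j)"
      using sum.group[OF finite fin(2) R(1), of "\<lambda>a. P a i j"] by simp
    moreover have "(\<Sum>r\<in>R. of_bool (r = r\<^sub>0) * (of_bool (i = j) - (\<Sum>a\<in>UNIV. P a i j))) =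
        of_bool (i = j) - (\<Sum>a\<in>UNIV. P a i j)"
      unfolding sum_distrib_right[symmetric] using fin(2) R(2) by (simp add: of_bool_def)
    ultimately show ?thesis
      by (simp add: E_def sum.distrib)
  qed
  ultimately show "povm_on B R E"
    by (simp add: povm_on_def)
qed

section \<open>Gates that permute the basis\<close>

definition perm_op :: "('b \<Rightarrow> 'c) \<Rightarrow> ('c \<Rightarrow> 'c) \<Rightarrow> 'b operator" where
  "perm_op dec \<pi> i j = of_bool (dec i = \<pi> (dec j))"

context
  fixes dec :: "'b \<Rightarrow> 'c::finite" and B :: "'b set" and \<pi> :: "'c \<Rightarrow> 'c"
  assumes dec: "bij_betw dec B UNIV" and inv: "\<And>v. \<pi> (\<pi> v) = v"
begin

text \<open>As \<pi> is its own inverse, the amplitude at \<open>i\<close> comes from the basis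
  element that decodes to \<open>\<pi> (dec i)\<close>.\<close>

lemma apply_perm_op:
  assumes "\<And>j. j \<in> B \<Longrightarrow> \<psi> j = \<Psi> (dec j)"
  shows "apply_op B (perm_op dec \<pi>) \<psi> i = \<Psi> (\<pi> (dec i))"
proof -
  have "apply_op B (perm_op dec \<pi>) \<psi> i = (\<Sum>j\<in>B. of_bool (dec i = \<pi> (dec j)) * \<Psi> (dec j))"
    using assms by (simp add: apply_op_def perm_op_def)
  also have "\<dots> = (\<Sum>v\<in>UNIV. of_bool (dec i = \<pi> v) * \<Psi> v)"
    by (rule sum.reindex_bij_betw[OF dec])
  also have "\<dots> = (\<Sum>v\<in>UNIV. if v = \<pi> (dec i) then \<Psi> v else 0)"
    by (intro sum.cong refl) (auto simp: inv)
  finally show ?thesis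
    by simp
qed

lemma unitary_perm_op: "unitary_on B (perm_op dec \<pi>)"
  unfolding unitary_on_def
proof (intro conjI ballI)
  fix i j assume ij: "i \<in> B" "j \<in> B"
  have inj: "dec i = dec j \<longleftrightarrow> i = j"
    using dec ij by (auto simp: bij_betw_def inj_on_def)
  have "(\<Sum>l\<in>B. cnj (perm_op dec \<pi> l i) * perm_op dec \<pi> l j) =
      (\<Sum>v\<in>UNIV. of_bool (v = \<pi> (dec i)) * of_bool (v = \<pi> (dec j)))"
    unfolding perm_op_def
    by (subst sum.reindex_bij_betw[OF dec, symmetric]) (auto simp: of_bool_def intro!: sum.cong)
  also have "\<dots> = (\<Sum>v\<in>UNIV. if v = \<pi> (dec i) then of_bool (\<pi> (dec i) = \<pi> (dec j)) else 0)"
    by (intro sum.cong) auto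
  also have "\<dots> = of_bool (i = j)"
    by (simp add: inj[symmetric]) (metis inv)
  finally show "(\<Sum>l\<in>B. cnj (perm_op dec \<pi> l i) * perm_op dec \<pi> l j) = of_bool (i = j)" .
  have "(\<Sum>l\<in>B. perm_op dec \<pi> i l * cnj (perm_op dec \<pi> j l)) =
      (\<Sum>v\<in>UNIV. of_bool (dec i = \<pi> v) * of_bool (dec j = \<pi> v))"
    unfolding perm_op_def
    by (subst sum.reindex_bij_betw[OF dec, symmetric]) (auto simp: of_bool_def intro!: sum.cong)
  also have "\<dots> = (\<Sum>v\<in>UNIV. if v = \<pi> (dec i) then of_bool (dec j = dec i) else 0)"
    by (intro sum.cong) (auto simp: inv)
  also have "\<dots> = of_bool (i = j)"
    by (simp add: inj[symmetric] eq_commute)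
  finally show "(\<Sum>l\<in>B. perm_op dec \<pi> i l * cnj (perm_op dec \<pi> j l)) = of_bool (i = j)" .
qed

end

section \<open>An optimal algorithm\<close>

lemma sum_proj_kernel_mult:
  fixes a c :: "'x::finite \<Rightarrow> 'g::finite"
  shows "(\<Sum>b\<in>UNIV. proj_kernel UNIV S a b * proj_kernel UNIV S c b) = proj_kernel UNIV S a c"
  unfolding proj_kernel_def prod.distrib[symmetric]
  by (simp add: sum_coord_kernel_mult
      sum_prod_UNIV[of "\<lambda>x b. coord_kernel (x \<in> S) (a x) b * coord_kernel (x \<in> S) (c x) b"])

text \<open>The sum over all \<open>S\<close> multiplies out to a product of sums of the two kernels
  at each coordinate. This makes the measurement vectors below orthonormal.\<close>

lemma sum_proj_kernel:
  fixes a c :: "'x::finite \<Rightarrow> 'g::finite"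
  shows "(\<Sum>S\<in>UNIV. proj_kernel UNIV S a c) = of_bool (a = c)"
proof -
  have "(\<Sum>S\<in>UNIV. proj_kernel UNIV S a c) = (\<Sum>S\<in>Pow UNIV.
      (\<Prod>x\<in>S. coord_kernel True (a x) (c x)) * (\<Prod>x\<in>UNIV-S. coord_kernel False (a x) (c x)))"
  proof (intro sum.cong)
    fix S :: "'x set"
    have "proj_kernel UNIV S a c = (\<Prod>x\<in>UNIV.
        if x \<in> S then coord_kernel True (a x) (c x) else coord_kernel False (a x) (c x))"
      unfolding proj_kernel_def by (intro prod.cong) auto
    then show "proj_kernel UNIV S a c =
        (\<Prod>x\<in>S. coord_kernel True (a x) (c x)) * (\<Prod>x\<in>UNIV-S. coord_kernel False (a x) (c x))"
      by (simp add: prod.If_cases Compl_eq_Diff_UNIV)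
  qed simp
  also have "\<dots> = (\<Prod>x\<in>UNIV. of_bool (a x = c x))"
    unfolding coord_kernel_add[symmetric] by (rule prod_add[symmetric]) simp
  also have "\<dots> = of_bool (a = c)"
    by (cases "a = c") (auto simp: fun_eq_iff intro!: prod_zero)
  finally show ?thesis .
qed

lemma card_agree_on:
  fixes A :: "'x::finite \<Rightarrow> 'g::finite"
  shows "card {B. \<forall>x\<in>Y. B x = A x} = CARD('g) ^ (CARD('x) - card Y)"
proof -
  have "card {B. \<forall>x\<in>Y. B x = A x} = (\<Sum>B | \<forall>x. x \<notin> -Y \<longrightarrow> B x = A x. \<Prod>x\<in>(UNIV :: 'x set). 1)"
    by (simp add: Ball_def)
  also have "\<dots> = (\<Prod>x\<in>UNIV. if x \<in> -Y then \<Sum>b\<in>(UNIV :: 'g set). 1 else 1)"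
    by (rule sum_prod_agree_off)
  also have "\<dots> = CARD('g) ^ card (-Y)"
    by (subst prod.If_cases) (auto simp: Compl_eq)
  finally show ?thesis
    by (simp add: Compl_eq_Diff_UNIV card_Diff_subset)
qed

text \<open>A basis element is rewritten as \<open>(x, b, S, h)\<close>: \<open>b\<close> is a table of registers whose entry at the
  query input \<open>x\<close> is the query register, and \<open>h\<close> is a spare register. A query then adds \<open>A x\<close> to
  the entry of \<open>b\<close> at \<open>x\<close>.\<close>

lemma table_coordinates:
  obtains d and dec :: "'x::finite \<times> 'g::{finite, ab_group_add} \<times> nat \<Rightarrow> 'x \<times> ('x \<Rightarrow> 'g) \<times> 'x set \<times> 'g"
  where "bij_betw dec (qbasis d) UNIV"
    and "\<And>x g z y b S h u. \<lbrakk>z < d; dec (x, g, z) = (y, b, S, h)\<rbrakk> \<Longrightarrow>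
      y = x \<and> dec (x, g - u, z) = (x, b(x := b x - u), S, h)"
proof -
  define d where "d = CARD('x set \<times> ('x \<Rightarrow> 'g))"
  obtain e where e: "bij_betw e {0..<d} (UNIV :: ('x set \<times> ('x \<Rightarrow> 'g)) set)"
    unfolding d_def using ex_bij_betw_nat_finite[OF finite] by blast
  define dec :: "'x \<times> 'g \<times> nat \<Rightarrow> 'x \<times> ('x \<Rightarrow> 'g) \<times> 'x set \<times> 'g"
    where "dec = (\<lambda>(x, g, z). (x, (snd (e z))(x := g), fst (e z), snd (e z) x))"
  define enc where "enc = (\<lambda>(x, b, S, h). (x, b x, inv_into {0..<d} e (S, b(x := h))))"
  have e_inv: "inv_into {0..<d} e (e z) = z" if "z < d" for z
    using e that by (simp add: bij_betw_def)
  have inv_e: "e (inv_into {0..<d} e w) = w" "inv_into {0..<d} e w < d" for w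
    using bij_betw_inv_into_right[OF e, of w] bij_betw_apply[OF bij_betw_inv_into[OF e], of w] by simp_all
  have "bij_betw dec (qbasis d) UNIV"
    by (rule bij_betw_byWitness[where f' = enc])
      (auto simp: dec_def enc_def qbasis_def e_inv inv_e)
  moreover have "y = x \<and> dec (x, g - u, z) = (x, b(x := b x - u), S, h)"
    if "z < d" "dec (x, g, z) = (y, b, S, h)" for x g z y b S h u
    using that(2) by (auto simp: dec_def)
  ultimately show thesis
    by (rule that)
qed

lemma sum_pinned:
  fixes G :: "'b::finite \<Rightarrow> 's::finite \<Rightarrow> 'c::comm_monoid_add"
    and p :: "'s \<Rightarrow> 'x::finite" and h\<^sub>0 :: "'h::finite"
  shows "(\<Sum>(x, b, S, h)\<in>UNIV. if x = p S \<and> h = h\<^sub>0 then G b S else 0) = (\<Sum>S\<in>UNIV. \<Sum>b\<in>UNIV. G b S)"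
proof -
  have "(\<Sum>(x, b, S, h)\<in>UNIV. if x = p S \<and> h = h\<^sub>0 then G b S else 0) =
      (\<Sum>(x, b, S, h)\<in>{(x, b, S, h). x = p S \<and> h = h\<^sub>0}. G b S)"
    by (rule sum.mono_neutral_cong_right) (auto split: if_splits)
  also have "\<dots> = (\<Sum>(S, b)\<in>UNIV. G b S)"
    by (rule sum.reindex_bij_witness[of _ "\<lambda>(S, b). (p S, b, S, h\<^sub>0)" "\<lambda>(x, b, S, h). (S, b)"]) auto
  also have "\<dots> = (\<Sum>S\<in>UNIV. \<Sum>b\<in>UNIV. G b S)"
    by (simp add: sum.cartesian_product)
  finally show ?thesis .
qed

text \<open>Padding \<open>S\<close> to exactly \<open>q\<close> inputs gives every branch the same
  number of queries, without repetition.\<close>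

lemma query_order_exists:
  fixes S :: "'x::finite set"
  assumes "card S \<le> q" "q < CARD('x)"
  obtains s :: "nat \<Rightarrow> 'x" where "inj_on s {..<q}" and "S \<subseteq> s ` {..<q}"
proof -
  obtain T where T: "S \<subseteq> T" "card T = q"
    using exists_subset_between[of S q UNIV] assms by auto
  obtain s where "bij_betw s {0..<q} T"
    using ex_bij_betw_nat_finite[of T] T by auto
  then show thesis
    using T that by (auto simp: bij_betw_def atLeast0LessThan)
qed

text \<open>The query input is a function of \<open>S\<close> and the spare register is zero, so
  inner products reduce to sums over \<open>S\<close> and \<open>b\<close>.\<close>

definition pinned ::
    "('x set \<Rightarrow> 'x) \<Rightarrow> ('x set \<Rightarrow> ('x \<Rightarrow> 'g) \<Rightarrow> real) \<Rightarrow> 'x \<times> ('x \<Rightarrow> 'g) \<times> 'x set \<times> 'g::zero \<Rightarrow> complex" where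
  "pinned p G = (\<lambda>(x, b, S, h). if x = p S \<and> h = 0 then of_real (G S b) else 0)"

lemma inner_on_pinned:
  fixes p :: "'x::finite set \<Rightarrow> 'x" and F G :: "'x set \<Rightarrow> ('x \<Rightarrow> 'g::{finite, zero}) \<Rightarrow> real"
  assumes "bij_betw dec B UNIV"
  shows "inner_on B (\<lambda>i. pinned p F (dec i)) (\<lambda>i. pinned p G (dec i)) =
    of_real (\<Sum>S\<in>UNIV. \<Sum>b\<in>UNIV. F S b * G S b)"
proof -
  have "inner_on B (\<lambda>i. pinned p F (dec i)) (\<lambda>i. pinned p G (dec i)) =
      (\<Sum>v\<in>UNIV. cnj (pinned p F v) * pinned p G v)"
    unfolding inner_on_def by (rule sum.reindex_bij_betw[OF assms])
  also have "\<dots> = (\<Sum>(x, b, S, h)\<in>UNIV. if x = p S \<and> h = (0 :: 'g) then complex_of_real (F S b * G S b) else 0)"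
    by (intro sum.cong) (auto simp: pinned_def)
  also have "\<dots> = of_real (\<Sum>S\<in>UNIV. \<Sum>b\<in>UNIV. F S b * G S b)"
    unfolding sum_pinned by simp
  finally show ?thesis .
qed

text \<open>The kernel is still centred at 0 in coordinate \<open>x\<close>, and the query moves
  that centre to \<open>A x\<close>.\<close>

lemma proj_kernel_query:
  fixes A :: "'x::finite \<Rightarrow> 'g::{finite, ab_group_add}"
  assumes "x \<notin> Q"
  shows "proj_kernel UNIV S (\<lambda>y. if y \<in> Q then A y else 0) (b(x := b x - A x)) =
    proj_kernel UNIV S (\<lambda>y. if y \<in> insert x Q then A y else 0) b"
  unfolding proj_kernel_def
  using assms by (intro prod.cong) (auto simp: coord_kernel_translate)

text \<open>Off \<open>S\<close> the kernel is constant, which is why knowing the oracle on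
  \<open>S\<close> suffices.\<close>

lemma proj_kernel_cong:
  assumes "\<And>x. x \<in> S \<Longrightarrow> A x = A' x"
  shows "proj_kernel Y S A B = proj_kernel Y S A' B"
  unfolding proj_kernel_def using assms by (intro prod.cong) (auto simp: coord_kernel_def)

text \<open>Every coordinate outside \<open>Y\<close> adds a constant factor, the inverse of the
  group order.\<close>

lemma proj_kernel_diag_sum:
  fixes Y :: "'x::finite set" and A :: "'x \<Rightarrow> 'g::finite"
  shows "(\<Sum>S | S \<subseteq> Y \<and> card S \<le> n. proj_kernel UNIV S A A) =
    low_kernel n Y A A / real CARD('g) ^ (CARD('x) - card Y)"
proof -
  have "real CARD('g) ^ card Y * real CARD('g) ^ (CARD('x) - card Y) = real CARD('g) ^ CARD('x)"
    by (simp add: power_add[symmetric] card_mono)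
  then show ?thesis
    by (simp add: low_kernel_def proj_kernel_agree sum_divide_distrib[symmetric])
qed

lemma low_kernel_diag_pos: "0 < low_kernel n Y A A"
proof -
  have "0 < proj_kernel Y {} A A"
    by (simp add: proj_kernel_def coord_kernel_def prod_pos)
  also have "\<dots> \<le> low_kernel n Y A A"
    unfolding low_kernel_def
    by (rule member_le_sum) (auto simp: proj_kernel_agree)
  finally show ?thesis .
qed

text \<open>Moves the query input from the current position to the next one. Exchanging the two
  inputs, rather than overwriting, keeps the gate a permutation.\<close>

definition swap_input ::
    "('x set \<Rightarrow> nat \<Rightarrow> 'x) \<Rightarrow> nat \<Rightarrow> 'x \<times> 'b \<times> 'x set \<times> 'h \<Rightarrow> 'x \<times> 'b \<times> 'x set \<times> 'h" where
  "swap_input s n = (\<lambda>(x, b, S, h).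
     (if x = s S n then s S (Suc n) else if x = s S (Suc n) then s S n else x, b, S, h))"

lemma swap_input_involution: "swap_input s n (swap_input s n v) = v"
  by (auto simp: swap_input_def split: prod.split)

lemma pinned_swap_input:
  "pinned (\<lambda>S. s S n) G (swap_input s n v) = pinned (\<lambda>S. s S (Suc n)) G v"
  by (auto simp: swap_input_def pinned_def split: prod.split)

text \<open>The initial state is a superposition over the sets \<open>S\<close>, with amplitude \<open>\<beta>\<close> times the projection
  of the zero table onto the component \<open>S\<close>. The registers outside \<open>S\<close> are uniform, hence unaffected
  by queries; so querying \<open>q\<close> inputs including \<open>S\<close> moves the zero table to \<open>A\<close>. The measurement then
  compares with the states that carry the projections of \<open>a\<close> onto all components \<open>S\<close>.\<close>

lemma optimal_algorithm:
  assumes "q < k" and "k \<le> CARD('x::finite)"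
  obtains a :: "('x::finite, 'g::{finite, ab_group_add}) qalg" where "query_algorithm q k a"
    and "1 / real CARD('g) ^ k * (\<Sum>i=0..q. real (k choose i) * (real CARD('g) - 1) ^ i) \<le> success_prob q k a"
proof -
  obtain Y :: "'x set" where Y: "card Y = k"
    using obtain_subset_with_card_n[OF assms(2)] by auto
  obtain ys where ys: "set ys = Y" "distinct ys"
    using finite_distinct_list[of Y] by auto
  have len: "length ys = k"
    using ys Y distinct_card by fastforce
  define good where "good = {S. S \<subseteq> Y \<and> card S \<le> q}"
  have "\<exists>s. inj_on s {..<q} \<and> S \<subseteq> s ` {..<q}" if "S \<in> good" for S
    by (rule query_order_exists[of S q]) (use that assms in \<open>auto simp: good_def\<close>)
  then obtain s :: "'x set \<Rightarrow> nat \<Rightarrow> 'x"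
    where s: "S \<in> good \<Longrightarrow> inj_on (s S) {..<q}" "S \<in> good \<Longrightarrow> S \<subseteq> s S ` {..<q}" for S
    by metis
  obtain d and dec :: "'x \<times> 'g \<times> nat \<Rightarrow> 'x \<times> ('x \<Rightarrow> 'g) \<times> 'x set \<times> 'g"
    where dec: "bij_betw dec (qbasis d) UNIV"
      and dec_shift: "\<And>x g z y b S h u. \<lbrakk>z < d; dec (x, g, z) = (y, b, S, h)\<rbrakk> \<Longrightarrow>
        y = x \<and> dec (x, g - u, z) = (x, b(x := b x - u), S, h)"
    by (rule table_coordinates) blast

  define Z :: "'x \<Rightarrow> 'g" where "Z = (\<lambda>_. 0)"
  define c where "c = 1 / real CARD('g) ^ k * (\<Sum>i=0..q. real (k choose i) * (real CARD('g) - 1) ^ i)"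
  \<comment> \<open>\<open>D\<close> is the squared norm of the initial superposition before
    normalisation by \<beta>.\<close>
  define D where "D = (\<Sum>S\<in>good. proj_kernel UNIV S Z Z)"
  define \<beta> where "\<beta> = 1 / sqrt D"
  have low: "low_kernel q Y A A = c" for A :: "'x \<Rightarrow> 'g"
    by (simp add: low_kernel_diag c_def Y)
  have D: "D = c / real CARD('g) ^ (CARD('x) - k)"
    unfolding D_def good_def proj_kernel_diag_sum low Y ..
  have "c > 0"
    using low low_kernel_diag_pos by metis
  then have \<beta>: "\<beta>\<^sup>2 * D = 1" "D > 0"
    by (simp_all add: D \<beta>_def power_divide)

  \<comment> \<open>The centre of the kernel in branch \<open>S\<close> after \<open>n\<close>
    queries.\<close>
  define answered where "answered A n S = (\<lambda>y. if y \<in> s S ` {..<n} then A y else 0)"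
    for A :: "'x \<Rightarrow> 'g" and n S
  define amp where "amp A n S b = of_bool (S \<in> good) * (\<beta> * proj_kernel UNIV S (answered A n S) b)"
    for A n S b
  define \<Psi> where "\<Psi> A n = pinned (\<lambda>S. s S n) (amp A n)" for A n
  \<comment> \<open>All \<open>S\<close> occur here, not only the good ones, as orthonormality
    requires. The input \<open>s S q\<close> is never queried and may be arbitrary; it is where the
    last gate leaves the query register.\<close>
  define \<eta> where "\<eta> a i = pinned (\<lambda>S. s S q) (\<lambda>S. proj_kernel UNIV S a) (dec i)" for a :: "'x \<Rightarrow> 'g" and i
  define f where "f a = map (\<lambda>y. (y, a y)) ys" for a :: "'x \<Rightarrow> 'g"

  have "inner_on (qbasis d) (\<eta> a) (\<eta> c) = of_bool (a = c)" for a c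
    unfolding \<eta>_def inner_on_pinned[OF dec] sum_proj_kernel_mult sum_proj_kernel by simp
  moreover have "range f \<subseteq> outcomes k"
    by (auto simp: f_def outcomes_def len)
  ultimately obtain E where E: "povm_on (qbasis d) (outcomes k) E"
    "\<And>r \<psi>. (\<Sum>a | f a = r. (cmod (inner_on (qbasis d) (\<eta> a) \<psi>))\<^sup>2) \<le> Re (quad_form (qbasis d) (E r) \<psi>)"
    using orthonormal_povm[OF finite_qbasis finite_outcomes, of d \<eta> f k "f Z"] by blast
  define alg where "alg = \<lparr>wdim = d, init = (\<lambda>i. \<Psi> Z 0 (dec i)),
    gate = (\<lambda>n. perm_op dec (swap_input s n)), meas = E\<rparr>"

  have "of_real (sq_norm (qbasis d) (\<lambda>i. \<Psi> Z 0 (dec i))) =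
      complex_of_real (\<Sum>S\<in>UNIV. \<Sum>b\<in>UNIV. amp Z 0 S b * amp Z 0 S b)"
    unfolding sq_norm_complex inner_on_def[symmetric] \<Psi>_def inner_on_pinned[OF dec] ..
  also have "(\<Sum>S\<in>UNIV. \<Sum>b\<in>UNIV. amp Z 0 S b * amp Z 0 S b) =
      (\<Sum>S\<in>UNIV. of_bool (S \<in> good) * (\<beta>\<^sup>2 * proj_kernel UNIV S Z Z))"
  proof (intro sum.cong refl)
    fix S
    have "(\<Sum>b\<in>UNIV. amp Z 0 S b * amp Z 0 S b) = (\<Sum>b\<in>UNIV. of_bool (S \<in> good) *
        (\<beta>\<^sup>2 * (proj_kernel UNIV S Z b * proj_kernel UNIV S Z b)))"
      by (intro sum.cong refl) (simp add: amp_def answered_def Z_def power2_eq_square)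
    then show "(\<Sum>b\<in>UNIV. amp Z 0 S b * amp Z 0 S b) =
        of_bool (S \<in> good) * (\<beta>\<^sup>2 * proj_kernel UNIV S Z Z)"
      unfolding sum_distrib_left[symmetric] sum_proj_kernel_mult .
  qed
  also have "\<dots> = \<beta>\<^sup>2 * D"
    by (simp add: D_def sum_distrib_left of_bool_def if_distrib[of "\<lambda>x. x * _"] sum.If_cases cong: if_cong)
  finally have "unit_state_on (qbasis d) (\<lambda>i. \<Psi> Z 0 (dec i))"
    by (simp add: \<beta> unit_state_on_def sq_norm_def del: of_real_sum flip: of_real_eq_iff)
  then have alg: "query_algorithm q k alg"
    using E(1) by (simp add: query_algorithm_def alg_def unitary_perm_op[OF dec swap_input_involution])

  have query: "\<Psi> A n (dec (x, g - A x, z)) = pinned (\<lambda>S. s S n) (amp A (Suc n)) (dec (x, g, z))"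
    if "z < d" "n < q" for A n x g z
  proof -
    obtain y b S h where v: "dec (x, g, z) = (y, b, S, h)"
      by (cases "dec (x, g, z)") auto
    note shift = dec_shift[OF that(1) v, of "A x"]
    have "amp A n S (b(x := b x - A x)) = amp A (Suc n) S b" if "x = s S n"
    proof (cases "S \<in> good")
      case True
      \<comment> \<open>Injectivity of the query order ensures that this coordinate has not been
        shifted before.\<close>
      have "x \<notin> s S ` {..<n}"
        using \<open>n < q\<close> \<open>x = s S n\<close> by (auto dest: inj_onD[OF s(1)[OF True]])
      then show ?thesis
        using \<open>x = s S n\<close> by (simp add: amp_def answered_def proj_kernel_query lessThan_Suc)
    qed (simp add: amp_def)
    then show ?thesis
      using shift by (simp add: v \<Psi>_def pinned_def)
  qed
  have state: "i \<in> qbasis d \<Longrightarrow> state_after alg A n i = \<Psi> A n (dec i)" if "n \<le> q" for A n i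
    using that
  proof (induction n arbitrary: i)
    case 0
    \<comment> \<open>Before any query the centre is the zero table for every oracle.\<close>
    have "amp Z 0 = amp A 0"
      by (intro ext) (simp add: amp_def answered_def Z_def)
    then show ?case
      by (simp add: alg_def \<Psi>_def)
  next
    case (Suc n)
    have "apply_op (qbasis d) (query_op A) (state_after alg A n) j =
        pinned (\<lambda>S. s S n) (amp A (Suc n)) (dec j)" if j: "j \<in> qbasis d" for j
    proof -
      obtain x g z where xgz: "j = (x, g, z)" "z < d"
        using j by (auto simp: qbasis_def)
      then have "(x, g - A x, z) \<in> qbasis d"
        by (simp add: qbasis_def)
      then show ?thesis
        using xgz Suc.prems by (simp add: apply_query_op Suc.IH query)
    qed
    then have "state_after alg A (Suc n) i =
        pinned (\<lambda>S. s S n) (amp A (Suc n)) (swap_input s n (dec i))"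
      using apply_perm_op[OF dec, where \<pi> = "swap_input s n", OF swap_input_involution]
      by (simp add: alg_def)
    then show ?case
      by (simp add: pinned_swap_input \<Psi>_def)
  qed

  have overlap: "inner_on (qbasis d) (\<eta> a) (state_after alg A q) = of_real (\<beta> * D)"
    if "f a = f A" for a A
  proof -
    have agree: "a y = A y" if "y \<in> Y" for y
      using \<open>f a = f A\<close> that ys(1) by (auto simp: f_def)
    have "inner_on (qbasis d) (\<eta> a) (state_after alg A q) =
        inner_on (qbasis d) (\<eta> a) (\<lambda>i. \<Psi> A q (dec i))"
      by (simp add: inner_on_def state)
    also have "\<dots> = of_real (\<Sum>S\<in>UNIV. \<Sum>b\<in>UNIV. proj_kernel UNIV S a b * amp A q S b)"
      unfolding \<eta>_def \<Psi>_def inner_on_pinned[OF dec] ..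
    also have "(\<Sum>S\<in>UNIV. \<Sum>b\<in>UNIV. proj_kernel UNIV S a b * amp A q S b) =
        (\<Sum>S\<in>good. \<Sum>b\<in>UNIV. proj_kernel UNIV S a b * amp A q S b)"
      by (rule sum.mono_neutral_right) (auto simp: amp_def)
    also have "\<dots> = (\<Sum>S\<in>good. \<beta> * proj_kernel UNIV S Z Z)"
    proof (intro sum.cong refl)
      fix S assume S: "S \<in> good"
      \<comment> \<open>All of \<open>S\<close> has been queried, and \<open>S\<close> lies in
        \<open>Y\<close>, where \<open>a\<close> and \<open>A\<close> agree.\<close>
      have "proj_kernel UNIV S (answered A q S) b = proj_kernel UNIV S a b" for b
        using s(2)[OF S] S agree by (intro proj_kernel_cong) (auto simp: answered_def good_def)
      then have "(\<Sum>b\<in>UNIV. proj_kernel UNIV S a b * amp A q S b) =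
          (\<Sum>b\<in>UNIV. \<beta> * (proj_kernel UNIV S a b * proj_kernel UNIV S a b))"
        using S by (simp add: amp_def mult_ac)
      also have "\<dots> = \<beta> * proj_kernel UNIV S a a"
        unfolding sum_distrib_left[symmetric] sum_proj_kernel_mult ..
      finally show "(\<Sum>b\<in>UNIV. proj_kernel UNIV S a b * amp A q S b) =
          \<beta> * proj_kernel UNIV S Z Z"
        by (simp add: proj_kernel_agree)
    qed
    finally show ?thesis
      by (simp add: D_def sum_distrib_left)
  qed
  have "c \<le> outcome_prob q alg A (f A)" for A
  proof -
    \<comment> \<open>Every extension of the answers on \<open>Y\<close> to a full table contributes
      \<open>(\<beta> * D)\<^sup>2\<close>, which is \<open>D\<close>; the number of extensions
      turns \<open>D\<close> into \<open>c\<close>.\<close>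
    have "{a. f a = f A} = {a. \<forall>y\<in>Y. a y = A y}"
      using ys(1) by (auto simp: f_def)
    then have "real (card {a. f a = f A}) = real CARD('g) ^ (CARD('x) - k)"
      by (simp add: card_agree_on Y)
    moreover have "(\<beta> * D)\<^sup>2 = D"
      using \<beta> by (simp add: power_mult_distrib power2_eq_square)
    ultimately have "c = (\<Sum>a | f a = f A. (\<beta> * D)\<^sup>2)"
      by (simp add: D)
    also have "\<dots> = (\<Sum>a | f a = f A. (cmod (inner_on (qbasis d) (\<eta> a) (state_after alg A q)))\<^sup>2)"
      by (intro sum.cong) (simp_all add: overlap norm_mult power_mult_distrib del: of_real_mult)
    also have "\<dots> \<le> outcome_prob q alg A (f A)"
      using E(2) by (simp add: outcome_prob_def alg_def)
    finally show ?thesis .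
  qed
  also have "outcome_prob q alg A (f A) \<le>
      (\<Sum>r | r \<in> outcomes k \<and> correct_output A r. outcome_prob q alg A r)" for A
  proof (rule member_le_sum)
    show "f A \<in> {r. r \<in> outcomes k \<and> correct_output A r}"
      using ys len by (auto simp: f_def outcomes_def correct_output_def comp_def)
    show "0 \<le> outcome_prob q alg A r"
      if "r \<in> {r. r \<in> outcomes k \<and> correct_output A r} - {f A}" for r
      using that E(1) unfolding outcome_prob_def by (intro psd_on_Re) (auto simp: povm_on_def alg_def)
  qed simp
  finally have "real CARD('x \<Rightarrow> 'g) * c \<le>
      (\<Sum>A\<in>UNIV. \<Sum>r | r \<in> outcomes k \<and> correct_output A r. outcome_prob q alg A r)"
    using sum_bounded_below[of "UNIV :: ('x \<Rightarrow> 'g) set" c] by auto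
  then have "c \<le> success_prob q k alg"
    unfolding success_prob_def by (subst pos_le_divide_eq) (simp_all add: card_gt_0_iff mult.commute)
  then show thesis
    using that alg by (simp add: c_def)
qed

theorem theorem5:
  fixes q k M N :: nat
  assumes "M = CARD('x::finite)" and "N = CARD('g::{finite, ab_group_add})"
    and "q < k" and "k \<le> M"
  shows "is_maximum
    (1 / real N ^ k * (\<Sum>i=0..q. real (k choose i) * (real N - 1) ^ i))
    {success_prob q k a | a :: ('x, 'g) qalg. query_algorithm q k a}"
proof -
  obtain a :: "('x, 'g) qalg" where a: "query_algorithm q k a"
    "1 / real N ^ k * (\<Sum>i=0..q. real (k choose i) * (real N - 1) ^ i) \<le> success_prob q k a"
    unfolding assms(2) by (rule optimal_algorithm[OF assms(3) assms(4)[unfolded assms(1)]])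
  have le: "success_prob q k b \<le> 1 / real N ^ k * (\<Sum>i=0..q. real (k choose i) * (real N - 1) ^ i)"
    if "query_algorithm q k b" for b :: "('x, 'g) qalg"
    unfolding assms(2) by (rule success_prob_le[OF that])
  have "1 / real N ^ k * (\<Sum>i=0..q. real (k choose i) * (real N - 1) ^ i) = success_prob q k a"
    by (rule order_antisym[OF a(2) le[OF a(1)]])
  then show ?thesis
    unfolding is_maximum_def using a(1) le by blast
qed

end
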